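(* Let $z_A$, $z_B$, $z_{AB}$ and $z_{A^{-1}B}$ be four complex numbers. Assume that $f(z_A)>0$ and $f(z_B)>0$, where $f(z)=|z|^4-8\,\mathrm{Re}(z^3)+18|z|^2-27$. Let $z=(z_A,z_B,z_{AB},z_{A^{-1}B})\in\mathbb{C}^4$ and let $Q=S^2-4P\in\mathbb{Z}[x_1,\dots,x_8]$, where $S$ and $P$ are the polynomials given in the context; write $Q(z,\overline z)$ for the value of $Q$ at $(x_1,x_2,x_3,x_4)=z$, $(x_5,x_6,x_7,x_8)=\overline z$. The following two conditions are equivalent. 1. There exists a pair $(\mathbf{A},\mathbf{B})$ of loxodromic matrices in $\mathrm{SU}(2,1)$ such that $(\mathrm{tr}\,\mathbf{A},\mathrm{tr}\,\mathbf{B},\mathrm{tr}\,\mathbf{A}\mathbf{B},\mathrm{tr}\,\mathbf{A}^{-1}\mathbf{B})=z$. 2. The inequality $Q(z,\overline z)\leq 0$ holds.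
   Context: $\mathrm{SU}(2,1)$ is the special unitary group of a Hermitian form of signature $(2,1)$ on $\mathbb{C}^3$. A matrix in $\mathrm{SU}(2,1)$ is loxodromic if the isometry of the complex hyperbolic plane it induces is loxodromic; equivalently it has an eigenvalue of modulus greater than $1$; equivalently its trace $t$ satisfies $f(t)>0$. The polynomials $S,P\in\mathbb{Z}[x_1,\dots,x_8]$ are $$S=x_1x_5+x_2x_6+x_3x_7+x_4x_8-x_1x_2x_7-x_5x_6x_3-x_5x_2x_8-x_1x_6x_4+x_1x_2x_5x_6-3$$ and $$\begin{aligned} P={}& x_5^2x_6x_1^2x_2+x_5x_6^2x_1x_2^2+x_4x_5^2x_2^2+x_5^2x_6^2x_7+x_6^2x_8x_1^2+x_1^2x_2^2x_3\\ &-x_4x_5x_6x_1^2-x_4x_6^2x_1x_2-x_5^2x_6x_1x_3-x_5^2x_8x_1x_2\\ &-x_5x_6^2x_2x_3-x_5x_6x_8x_2^2-x_5x_7x_1^2x_2-x_6x_7x_1x_2^2\\ &-x_5^3x_6x_2-x_5x_6^3x_1-x_5x_1x_2^3-x_6x_1^3x_2\\ &-x_4x_5x_6x_7x_2-x_4x_5x_1x_2x_3-x_5x_6x_7x_8x_1-x_6x_8x_1x_2x_3\\ &+x_4^2x_6x_7+x_4^2x_1x_3+x_4x_5^2x_6+x_4x_5x_3^2+x_4x_6^2x_3\\ &+x_4x_7^2x_2+x_4x_7x_1^2+x_4x_1x_2^2+x_5^2x_7x_2+x_5^2x_8x_3\\ &+x_5x_6^2x_8+x_5x_7x_8^2+x_5x_2^2x_3+x_6^2x_7x_1+x_6x_8x_3^2\\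 &+x_6x_1^2x_3+x_7^2x_8x_1+x_7x_8x_2^2+x_8^2x_2x_3+x_8x_1^2x_2\\ &-2x_4^2x_5x_2-2x_5x_6x_7^2-2x_6x_8^2x_1-2x_1x_2x_3^2\\ &+x_4x_5x_8x_1+x_4x_6x_8x_2+x_4x_7x_8x_3+x_5x_6x_1x_2+x_5x_7x_1x_3+x_6x_7x_2x_3\\ &+x_1^3+x_2^3+x_3^3+x_4^3+x_5^3+x_6^3+x_7^3+x_8^3\\ &-3x_4x_5x_7-3x_4x_2x_3-3x_6x_7x_8-3x_8x_1x_3\\ &+3x_4x_6x_1+3x_5x_6x_3+3x_5x_8x_2+3x_7x_1x_2\\ &-6x_4x_8-6x_5x_1-6x_6x_2-6x_7x_3+9. \end{aligned}$$ *)

theory Defs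
  imports "HOL-Analysis.Analysis"
begin

definition hermitian_form :: "(complex ^ 3 \<Rightarrow> complex ^ 3 \<Rightarrow> complex) \<Rightarrow> bool" where
  "hermitian_form h \<longleftrightarrow>
     (\<forall>u v w. h (u + v) w = h u w + h v w) \<and>
     (\<forall>c v w. h (c *s v) w = c * h v w) \<and>
     (\<forall>v w. h w v = cnj (h v w))"

text \<open>
  A Hermitian form has signature (2,1) if it has an orthonormal basis with two vectors of norm 1
  and one of norm -1. Three such vectors are automatically linearly independent, and by Sylvester's
  law the signs do not depend on the basis.
\<close>

definition signature_2_1 :: "(complex ^ 3 \<Rightarrow> complex ^ 3 \<Rightarrow> complex) \<Rightarrow> bool" where
  "signature_2_1 h \<longleftrightarrow>
     (\<exists>e1 e2 e3. h e1 e1 = 1 \<and> h e2 e2 = 1 \<and> h e3 e3 = -1 \<and>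
        h e1 e2 = 0 \<and> h e1 e3 = 0 \<and> h e2 e3 = 0)"

definition SU :: "(complex ^ 3 \<Rightarrow> complex ^ 3 \<Rightarrow> complex) \<Rightarrow> (complex ^ 3 ^ 3) set" where
  "SU h = {A. det A = 1 \<and> (\<forall>v w. h (A *v v) (A *v w) = h v w)}"

text \<open>
  Projective model: the points of the complex hyperbolic plane are the complex lines spanned by
  negative vectors, the points of its boundary are the lines spanned by nonzero null vectors.
  The values \<open>h v v\<close> are real for a Hermitian form.
\<close>

definition hyperbolic_plane :: "(complex ^ 3 \<Rightarrow> complex ^ 3 \<Rightarrow> complex) \<Rightarrow> (complex ^ 3) set set" where
  "hyperbolic_plane h = {vec.span {v} | v. Re (h v v) < 0}"

definition hyperbolic_boundary :: "(complex ^ 3 \<Rightarrow> complex ^ 3 \<Rightarrow> complex) \<Rightarrow> (complex ^ 3) set set" where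
  "hyperbolic_boundary h = {vec.span {v} | v. v \<noteq> 0 \<and> h v v = 0}"

definition line_map :: "complex ^ 3 ^ 3 \<Rightarrow> (complex ^ 3) set \<Rightarrow> (complex ^ 3) set" where
  "line_map A L = (\<lambda>v. A *v v) ` L"

definition loxodromic ::
    "(complex ^ 3 \<Rightarrow> complex ^ 3 \<Rightarrow> complex) \<Rightarrow> complex ^ 3 ^ 3 \<Rightarrow> bool" where
  "loxodromic h A \<longleftrightarrow>
     (\<forall>L \<in> hyperbolic_plane h. line_map A L \<noteq> L) \<and>
     card {L \<in> hyperbolic_boundary h. line_map A L = L} = 2"

definition goldman_f :: "complex \<Rightarrow> real" where
  "goldman_f z = cmod z ^ 4 - 8 * Re (z ^ 3) + 18 * cmod z ^ 2 - 27"

text \<open>Integer polynomials in eight variables, given by their values in any commutative ring.\<close>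

definition poly_S :: "'a::comm_ring_1 \<Rightarrow> 'a \<Rightarrow> 'a \<Rightarrow> 'a \<Rightarrow> 'a \<Rightarrow> 'a \<Rightarrow> 'a \<Rightarrow> 'a \<Rightarrow> 'a" where
  "poly_S x1 x2 x3 x4 x5 x6 x7 x8 =
      x1 * x5 + x2 * x6 + x3 * x7 + x4 * x8 - x1 * x2 * x7 - x5 * x6 * x3 - x5 * x2 * x8 - x1 * x6 * x4 + x1 * x2 * x5 * x6 - 3"

definition poly_P :: "'a::comm_ring_1 \<Rightarrow> 'a \<Rightarrow> 'a \<Rightarrow> 'a \<Rightarrow> 'a \<Rightarrow> 'a \<Rightarrow> 'a \<Rightarrow> 'a \<Rightarrow> 'a" where
  "poly_P x1 x2 x3 x4 x5 x6 x7 x8 =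
      x5^2 * x6 * x1^2 * x2 + x5 * x6^2 * x1 * x2^2 + x4 * x5^2 * x2^2 + x5^2 * x6^2 * x7 + x6^2 * x8 * x1^2 + x1^2 * x2^2 * x3
      - x4 * x5 * x6 * x1^2 - x4 * x6^2 * x1 * x2 - x5^2 * x6 * x1 * x3 - x5^2 * x8 * x1 * x2
      - x5 * x6^2 * x2 * x3 - x5 * x6 * x8 * x2^2 - x5 * x7 * x1^2 * x2 - x6 * x7 * x1 * x2^2
      - x5^3 * x6 * x2 - x5 * x6^3 * x1 - x5 * x1 * x2^3 - x6 * x1^3 * x2
      - x4 * x5 * x6 * x7 * x2 - x4 * x5 * x1 * x2 * x3 - x5 * x6 * x7 * x8 * x1 - x6 * x8 * x1 * x2 * x3
      + x4^2 * x6 * x7 + x4^2 * x1 * x3 + x4 * x5^2 * x6 + x4 * x5 * x3^2 + x4 * x6^2 * x3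
      + x4 * x7^2 * x2 + x4 * x7 * x1^2 + x4 * x1 * x2^2 + x5^2 * x7 * x2 + x5^2 * x8 * x3
      + x5 * x6^2 * x8 + x5 * x7 * x8^2 + x5 * x2^2 * x3 + x6^2 * x7 * x1 + x6 * x8 * x3^2
      + x6 * x1^2 * x3 + x7^2 * x8 * x1 + x7 * x8 * x2^2 + x8^2 * x2 * x3 + x8 * x1^2 * x2
      - 2 * x4^2 * x5 * x2 - 2 * x5 * x6 * x7^2 - 2 * x6 * x8^2 * x1 - 2 * x1 * x2 * x3^2
      + x4 * x5 * x8 * x1 + x4 * x6 * x8 * x2 + x4 * x7 * x8 * x3 + x5 * x6 * x1 * x2 + x5 * x7 * x1 * x3 + x6 * x7 * x2 * x3
      + x1^3 + x2^3 + x3^3 + x4^3 + x5^3 + x6^3 + x7^3 + x8^3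
      - 3 * x4 * x5 * x7 - 3 * x4 * x2 * x3 - 3 * x6 * x7 * x8 - 3 * x8 * x1 * x3
      + 3 * x4 * x6 * x1 + 3 * x5 * x6 * x3 + 3 * x5 * x8 * x2 + 3 * x7 * x1 * x2
      - 6 * x4 * x8 - 6 * x5 * x1 - 6 * x6 * x2 - 6 * x7 * x3 + 9"

definition poly_Q :: "'a::comm_ring_1 \<Rightarrow> 'a \<Rightarrow> 'a \<Rightarrow> 'a \<Rightarrow> 'a \<Rightarrow> 'a \<Rightarrow> 'a \<Rightarrow> 'a \<Rightarrow> 'a" where
  "poly_Q x1 x2 x3 x4 x5 x6 x7 x8 =
      poly_S x1 x2 x3 x4 x5 x6 x7 x8 ^ 2 - 4 * poly_P x1 x2 x3 x4 x5 x6 x7 x8"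

text \<open>
  At conjugate arguments \<open>poly_Q\<close> takes real values, so that an inequality about such a value is an
  inequality about its real part.
\<close>

lemma poly_Q_cnj_real:
  "poly_Q z1 z2 z3 z4 (cnj z1) (cnj z2) (cnj z3) (cnj z4) \<in> \<real>"
proof -
  have S: "cnj (poly_S z1 z2 z3 z4 (cnj z1) (cnj z2) (cnj z3) (cnj z4)) =
      poly_S z1 z2 z3 z4 (cnj z1) (cnj z2) (cnj z3) (cnj z4)"
    unfolding poly_S_def by (simp add: algebra_simps)
  have P: "cnj (poly_P z1 z2 z3 z4 (cnj z1) (cnj z2) (cnj z3) (cnj z4)) =
      poly_P z1 z2 z3 z4 (cnj z1) (cnj z2) (cnj z3) (cnj z4)"
    unfolding poly_P_def by (simp add: algebra_simps)
  show ?thesis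
    unfolding Reals_cnj_iff poly_Q_def by (simp add: S P)
qed

end

theory Submission
  imports Defs "HOL-Computational_Algebra.Fundamental_Theorem_Algebra"
begin

text \<open>
  If \<open>f (tr A) > 0\<close>, then the eigenvalues of \<open>A\<close> are \<open>m\<close>, \<open>m\<^sup>*/m\<close>, \<open>1/m\<^sup>*\<close> for some \<open>m\<close> with
  \<open>\<bar>m\<bar> > 1\<close> (a star denotes conjugation), and suitably scaled eigenvectors form a basis in which the
  Hermitian form is the antidiagonal one, \<open>x\<^sub>1 y\<^sub>3\<^sup>* + x\<^sub>2 y\<^sub>2\<^sup>* + x\<^sub>3 y\<^sub>1\<^sup>*\<close>
  (\<open>SU_eigenframe\<close>). The outer two eigenvectors span the only boundary points fixed by \<open>A\<close>, whence
  \<open>A\<close> is loxodromic (\<open>goldman_f_pos_imp_loxodromic\<close>).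

  Work in this basis. Then \<open>A\<close> is diagonal with distinct entries, so that \<open>tr B\<close>, \<open>tr AB\<close> and
  \<open>tr A\<^sup>-\<^sup>1B\<close> depend on \<open>B\<close> only through its diagonal \<open>d\<^sub>1, d\<^sub>2, d\<^sub>3\<close>, and, by a Vandermonde
  determinant, they can be prescribed by choosing this diagonal
  (\<open>interpolate_diagonal\<close>). So the question is which triples are diagonals of matrices of the special
  unitary group. Put \<open>T = 1 + \<bar>d\<^sub>2\<bar>\<^sup>2 - 2 Re (d\<^sub>1 d\<^sub>3\<^sup>*)\<close> and \<open>y = d\<^sub>1 d\<^sub>3 - d\<^sub>2\<^sup>*\<close>.

  The inverse of a special unitary matrix \<open>b\<close> is both its adjugate and its adjoint for the
  form. Comparing the two gives \<open>b\<^sub>1\<^sub>3 b\<^sub>3\<^sub>1 = y\<close> and \<open>2 Re (b\<^sub>3\<^sub>1 b\<^sub>1\<^sub>3\<^sup>*) = T\<close>, hence \<open>\<bar>T\<bar> \<le> 2 \<bar>y\<bar>\<close>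
  (\<open>SU_witt_diagonal_inequality\<close>). Conversely, under this inequality there is a number of modulus
  \<open>\<bar>y\<bar>\<close> and real part \<open>T/2\<close>; it serves as \<open>b\<^sub>1\<^sub>3 b\<^sub>3\<^sub>1\<^sup>*\<close>. For \<open>y \<noteq> 0\<close> this determines the two corner
  entries up to a common sign and conjugation by diagonal matrices, and for one of the signs the rest of
  \<open>b\<close> can be filled in (\<open>ex_SU_witt_diagonal\<close>).

  Finally \<open>Q = f (tr A) (T\<^sup>2 - 4 \<bar>y\<bar>\<^sup>2)\<close> (\<open>poly_Q_diagonal\<close>), so that \<open>\<bar>T\<bar> \<le> 2 \<bar>y\<bar>\<close> says exactly
  \<open>Q \<le> 0\<close>.
\<close>

section \<open>Witt frames of a form of signature (2,1)\<close>

definition witt_form :: "complex ^ 3 \<Rightarrow> complex ^ 3 \<Rightarrow> complex" where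
  "witt_form x y = x$1 * cnj (y$3) + x$2 * cnj (y$2) + x$3 * cnj (y$1)"

text \<open>
  The columns of \<open>P\<close> form a basis of two null vectors, with product 1, and a unit vector orthogonal
  to both: a Witt basis of \<open>h\<close>.
\<close>

definition witt_frame :: "(complex ^ 3 \<Rightarrow> complex ^ 3 \<Rightarrow> complex) \<Rightarrow> complex ^ 3 ^ 3 \<Rightarrow> bool" where
  "witt_frame h P \<longleftrightarrow> (\<forall>x y. h (P *v x) (P *v y) = witt_form x y)"

definition from_columns :: "complex ^ 3 \<Rightarrow> complex ^ 3 \<Rightarrow> complex ^ 3 \<Rightarrow> complex ^ 3 ^ 3" where
  "from_columns u v w = transpose (vector [u, v, w])"

definition diag3 :: "complex \<Rightarrow> complex \<Rightarrow> complex \<Rightarrow> complex ^ 3 ^ 3" where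
  "diag3 a b c = vector [vector [a, 0, 0], vector [0, b, 0], vector [0, 0, c]]"

lemma from_columns_nth [simp]:
  "from_columns u v w $ i $ 1 = u $ i" "from_columns u v w $ i $ 2 = v $ i"
  "from_columns u v w $ i $ 3 = w $ i"
  by (simp_all add: from_columns_def transpose_def)

lemma from_columns_mult:
  "from_columns u v w *v x = x$1 *s u + x$2 *s v + x$3 *s w"
  by (simp add: vec_eq_iff matrix_vector_mult_def sum_3 mult.commute)

lemma diag3_mult: "diag3 a b c *v x = vector [a * x$1, b * x$2, c * x$3]"
  by (simp add: vec_eq_iff matrix_vector_mult_def sum_3 forall_3 diag3_def)

lemma trace_diag3_mult: "trace (diag3 a b c ** M) = a * M$1$1 + b * M$2$2 + c * M$3$3"
  by (simp add: trace_def matrix_matrix_mult_def sum_3 diag3_def)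

lemma diag3_inverse:
  assumes "a \<noteq> 0" "b \<noteq> 0" "c \<noteq> 0"
  shows "diag3 a b c ** diag3 (1/a) (1/b) (1/c) = mat 1"
  using assms by (simp add: vec_eq_iff forall_3 matrix_matrix_mult_def sum_3 diag3_def mat_def)

lemma hermitian_expand:
  assumes "hermitian_form h"
  shows "h (a *s u + b *s v + c *s w) (a' *s u' + b' *s v' + c' *s w') =
      a * cnj a' * h u u' + a * cnj b' * h u v' + a * cnj c' * h u w' +
      b * cnj a' * h v u' + b * cnj b' * h v v' + b * cnj c' * h v w' +
      c * cnj a' * h w u' + c * cnj b' * h w v' + c * cnj c' * h w w'"
proof -
  have add: "h (p + q) r = h p r + h q r" and scale: "h (k *s p) r = k * h p r"
    and sym: "h q p = cnj (h p q)" for p q r k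
    using assms unfolding hermitian_form_def by blast+
  have add': "h r (p + q) = h r p + h r q" for p q r
    unfolding sym[where q = r] add by simp
  have scale': "h r (k *s p) = cnj k * h r p" for p r k
    unfolding sym[where q = r] scale by simp
  show ?thesis
    by (simp add: add add' scale scale' algebra_simps)
qed

lemma witt_frame_columnsI:
  assumes h: "hermitian_form h"
    and "h u u = 0" "h u v = 0" "h u w = 1" "h v v = 1" "h v w = 0" "h w w = 0"
  shows "witt_frame h (from_columns u v w)"
proof -
  have "h v u = 0" "h w u = 1" "h w v = 0"
    using h assms(3,4,6) unfolding hermitian_form_def by (metis complex_cnj_zero complex_cnj_one)+
  then show ?thesis
    using assms by (simp add: witt_frame_def from_columns_mult hermitian_expand[OF h] witt_form_def)
qed

lemma hermitian_witt_form: "hermitian_form witt_form"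
  by (simp add: hermitian_form_def witt_form_def algebra_simps)

text \<open>If \<open>e1\<close>, \<open>e2\<close>, \<open>e3\<close> have norms 1, 1, -1, then \<open>(e1 \<plusminus> e3)/\<surd>2\<close> are null and have product 1.\<close>

lemma witt_frame_exists:
  assumes h: "hermitian_form h" and "signature_2_1 h"
  obtains P where "witt_frame h P"
proof -
  obtain e1 e2 e3 where e: "h e1 e1 = 1" "h e2 e2 = 1" "h e3 e3 = -1"
      "h e1 e2 = 0" "h e1 e3 = 0" "h e2 e3 = 0"
    using assms(2) unfolding signature_2_1_def by blast
  have e': "h e2 e1 = 0" "h e3 e1 = 0" "h e3 e2 = 0"
    using h e unfolding hermitian_form_def by (metis complex_cnj_zero)+
  define s where "s = complex_of_real (sqrt (1/2))"
  have "s * s = complex_of_real (sqrt (1/2) * sqrt (1/2))"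
    unfolding s_def of_real_mult ..
  then have s: "s * s = 1/2" "cnj s = s"
    by (simp_all add: s_def real_sqrt_mult_self)
  have "witt_frame h (from_columns (s *s e1 + 0 *s e2 + s *s e3) (0 *s e1 + 1 *s e2 + 0 *s e3)
          (s *s e1 + 0 *s e2 + (-s) *s e3))"
    by (rule witt_frame_columnsI[OF h]; simp only: hermitian_expand[OF h] e e'; simp add: s)
  then show thesis by (rule that)
qed

text \<open>A kernel vector would be orthogonal to everything, but the antidiagonal form is nondegenerate.\<close>

lemma witt_frame_kernel:
  assumes "witt_frame h P" "P *v x = 0"
  shows "x = 0"
proof -
  have "witt_form x y = witt_form 0 y" for y
    using assms(1)[unfolded witt_frame_def, rule_format, of x y]
      assms(1)[unfolded witt_frame_def, rule_format, of 0 y] assms(2) by simp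
  from this[of "axis 1 1"] this[of "axis 2 1"] this[of "axis 3 1"] show ?thesis
    by (simp add: witt_form_def vec_eq_iff forall_3 axis_def)
qed

lemma witt_frame_inverse:
  assumes "witt_frame h P"
  obtains R where "P ** R = mat 1" "R ** P = mat 1"
proof -
  obtain R where "R ** P = mat 1"
    using witt_frame_kernel[OF assms] matrix_left_invertible_ker[of P] by blast
  then show thesis
    using that matrix_left_right_inverse by blast
qed

section \<open>The special unitary group in a Witt frame\<close>

lemma SU_conjugate:
  assumes P: "witt_frame h P" and R: "P ** R = mat 1" "R ** P = mat 1"
  shows "P ** M ** R \<in> SU h \<longleftrightarrow> M \<in> SU witt_form"
proof -
  have "det P * det R = 1"
    using arg_cong[OF R(1), of det] by (simp add: det_mul)
  then have "det (P ** M ** R) = det M"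
    by (simp add: det_mul mult.commute mult.left_commute)
  moreover have "(\<forall>v w. h ((P ** M ** R) *v v) ((P ** M ** R) *v w) = h v w) \<longleftrightarrow>
      (\<forall>x y. witt_form (M *v x) (M *v y) = witt_form x y)"
  proof -
    have "h ((P ** M ** R) *v v) ((P ** M ** R) *v w) = witt_form (M *v (R *v v)) (M *v (R *v w))"
      "h v w = witt_form (R *v v) (R *v w)" for v w
    proof -
      show "h ((P ** M ** R) *v v) ((P ** M ** R) *v w) = witt_form (M *v (R *v v)) (M *v (R *v w))"
        using P unfolding witt_frame_def by (simp add: flip: matrix_vector_mul_assoc)
      have "P *v (R *v v) = v" "P *v (R *v w) = w"
        by (simp_all add: matrix_vector_mul_assoc R)
      then show "h v w = witt_form (R *v v) (R *v w)"
        using P[unfolded witt_frame_def, rule_format, of "R *v v" "R *v w"] by simp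
    qed
    moreover have "R *v (P *v x) = x" for x
      by (simp add: matrix_vector_mul_assoc R)
    ultimately show ?thesis by metis
  qed
  ultimately show ?thesis by (simp add: SU_def)
qed

lemma traces_conjugate:
  fixes E F M P R :: "complex ^ 3 ^ 3"
  assumes R: "P ** R = mat 1" "R ** P = mat 1" and EF: "E ** F = mat 1"
    and A: "A = P ** E ** R" and B: "B = P ** M ** R"
  shows "trace A = trace E" "trace B = trace M"
    "trace (A ** B) = trace (E ** M)" "trace (matrix_inv A ** B) = trace (F ** M)"
proof -
  have tr: "trace (P ** X ** R) = trace X" for X :: "complex ^ 3 ^ 3"
    using trace_mul_sym[of "P ** X" R] by (simp add: matrix_mul_assoc R)
  have mul: "(P ** X ** R) ** (P ** Y ** R) = P ** (X ** Y) ** R" for X Y :: "complex ^ 3 ^ 3"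
  proof -
    have "(P ** X ** R) ** (P ** Y ** R) = P ** X ** (R ** P) ** Y ** R"
      by (simp only: matrix_mul_assoc)
    then show ?thesis by (simp add: R matrix_mul_assoc)
  qed
  have FE: "F ** E = mat 1" using EF matrix_left_right_inverse by blast
  have AF: "A ** (P ** F ** R) = mat 1" "(P ** F ** R) ** A = mat 1"
    by (simp_all add: A mul EF FE R)
  then have "\<exists>X. A ** X = mat 1 \<and> X ** A = mat 1"
    by blast
  then have inv: "A ** matrix_inv A = mat 1"
    unfolding matrix_inv_def by (rule someI_ex[THEN conjunct1])
  have "matrix_inv A = (P ** F ** R) ** A ** matrix_inv A"
    using AF(2) by simp
  also have "\<dots> = P ** F ** R"
    by (simp add: inv flip: matrix_mul_assoc)
  finally show "trace (matrix_inv A ** B) = trace (F ** M)"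
    by (simp add: B mul tr)
  show "trace A = trace E" "trace B = trace M" "trace (A ** B) = trace (E ** M)"
    by (simp_all add: A B mul tr)
qed

text \<open>
  The matrix with entries \<open>cnj (M $ (4-j) $ (4-i))\<close> is a left inverse of \<open>M\<close> because \<open>M\<close> preserves the
  form; as \<open>det M = 1\<close>, it is the adjugate of \<open>M\<close>, and therefore also a right inverse. The first three
  equations compare the diagonals of the two descriptions, the last two are entries of the
  products of \<open>M\<close> with its inverse.
\<close>

lemma SU_witt_entries:
  assumes M: "M \<in> SU witt_form"
  shows "M$2$2 * M$3$3 - M$2$3 * M$3$2 = cnj (M$3$3)"
    "M$1$1 * M$3$3 - M$1$3 * M$3$1 = cnj (M$2$2)"
    "M$1$1 * M$2$2 - M$1$2 * M$2$1 = cnj (M$1$1)"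
    "M$1$1 * cnj (M$3$3) + M$2$1 * cnj (M$2$3) + M$3$1 * cnj (M$1$3) = 1"
    "M$2$1 * cnj (M$2$3) + M$2$2 * cnj (M$2$2) + M$2$3 * cnj (M$2$1) = 1"
proof -
  have det: "det M = 1" using M by (simp add: SU_def)
  have col: "M *v axis i 1 = column i M" for i
    by (simp add: vec_eq_iff matrix_vector_mult_def column_def axis_def if_distrib[of "(*) _"] cong: if_cong)
  have "witt_form (column i M) (column j M) = witt_form (axis i 1) (axis j 1)" for i j
    using M unfolding SU_def col[symmetric] by blast
  note c = this[unfolded witt_form_def column_def axis_def]
  note det' = det[unfolded det_3]
  \<comment> \<open>The three entries in one row of the product of the inverse with \<open>M\<close>.\<close>
  note row1 = c[of 1 3, simplified] c[of 2 3, simplified] c[of 3 3, simplified]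
  note row2 = c[of 1 2, simplified] c[of 2 2, simplified] c[of 3 2, simplified]
  note row3 = c[of 1 1, simplified] c[of 2 1, simplified] c[of 3 1, simplified]
  show 1: "M$2$2 * M$3$3 - M$2$3 * M$3$2 = cnj (M$3$3)"
    using row1 det' by algebra
  show 2: "M$1$1 * M$3$3 - M$1$3 * M$3$1 = cnj (M$2$2)"
    using row2 det' by algebra
  show 3: "M$1$1 * M$2$2 - M$1$2 * M$2$1 = cnj (M$1$1)"
    using row3 det' by algebra
  show 4: "M$1$1 * cnj (M$3$3) + M$2$1 * cnj (M$2$3) + M$3$1 * cnj (M$1$3) = 1"
    using row1(1) .
  have 5: "cnj (M$2$3) = M$1$3 * M$3$2 - M$1$2 * M$3$3"
    using row1 det' by algebra
  have 6: "cnj (M$2$1) = M$1$2 * M$3$1 - M$1$1 * M$3$2"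
    using row3 det' by algebra
  show "M$2$1 * cnj (M$2$3) + M$2$2 * cnj (M$2$2) + M$2$3 * cnj (M$2$1) = 1"
    unfolding 5 6 2[symmetric] using det' by algebra
qed


section \<open>Eigenvalues from the trace\<close>

lemma goldman_f_complex:
  "complex_of_real (goldman_f z) = z^2 * cnj z^2 - 4 * z^3 - 4 * cnj z^3 + 18 * z * cnj z - 27"
proof -
  have "complex_of_real (cmod z)^2 = z * cnj z"
    using complex_norm_square[of z] by simp
  moreover have "complex_of_real (2 * Re (z^3)) = z^3 + cnj z^3"
    using complex_add_cnj[of "z^3"] by simp
  moreover have "complex_of_real (goldman_f z) =
      (complex_of_real (cmod z)^2)^2 - 4 * complex_of_real (2 * Re (z^3))
      + 18 * complex_of_real (cmod z)^2 - 27"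
    by (simp add: goldman_f_def)
  ultimately show ?thesis by algebra
qed

text \<open>
  The characteristic polynomial of a special unitary matrix of trace \<open>z\<close> is
  \<open>X\<^sup>3 - z X\<^sup>2 + cnj z X - 1\<close>, and \<open>f z\<close> is its discriminant.
\<close>

lemma goldman_f_discriminant:
  assumes "z = a + b + c" "cnj z = a*b + b*c + c*a" "a*b*c = 1"
  shows "complex_of_real (goldman_f z) = ((a - b) * (b - c) * (c - a))^2"
  unfolding goldman_f_complex using assms by algebra

text \<open>
  On the unit circle conjugation inverts the roots. As their product is 1, this changes the sign
  of the Vandermonde product; so the product is imaginary and its square is not positive.
\<close>

lemma unit_roots_goldman_f:
  assumes z: "z = a + b + c" "cnj z = a*b + b*c + c*a" and abc: "a*b*c = 1"
    and unit: "cmod a = 1" "cmod b = 1" "cmod c = 1"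
  shows "goldman_f z \<le> 0"
proof -
  define V where "V = (a - b) * (b - c) * (c - a)"
  have "a * cnj a = 1" "b * cnj b = 1" "c * cnj c = 1"
    using unit by (simp_all flip: complex_norm_square)
  then have "cnj a = b*c" "cnj b = c*a" "cnj c = a*b"
    using abc by algebra+
  then have "cnj V = (b*c - c*a) * (c*a - a*b) * (a*b - b*c)"
    by (simp add: V_def)
  also have "\<dots> = - V"
    unfolding V_def using abc by algebra
  finally have "V^2 = - (V * cnj V)"
    by (simp add: power2_eq_square)
  also have "\<dots> = complex_of_real (- ((cmod V)^2))"
    by (simp only: complex_norm_square of_real_minus)
  finally have "goldman_f z = - ((cmod V)^2)"
    unfolding V_def using goldman_f_discriminant[OF z abc] of_real_eq_iff by metis
  then show ?thesis by simp
qed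

lemma complex_cubic_roots:
  obtains a b c :: complex where "p = a + b + c" "q = a*b + b*c + c*a" "r = a*b*c"
proof -
  have "\<exists>a. poly [:-r, q, -p, 1:] a = 0"
    by (rule fundamental_theorem_of_algebra) (auto simp: constant_degree)
  then obtain a where a: "a^3 - p * a^2 + q * a - r = 0"
    by (auto simp: algebra_simps power2_eq_square power3_eq_cube)
  have "\<exists>b. poly [:q - a * (p - a), -(p - a), 1:] b = 0"
    by (rule fundamental_theorem_of_algebra) (auto simp: constant_degree)
  then obtain b where b: "b^2 - (p - a) * b + q - a * (p - a) = 0"
    by (auto simp: algebra_simps power2_eq_square)
  show thesis
  proof (rule that)
    show "p = a + b + (p - a - b)" by simp
    show "q = a*b + b*(p - a - b) + (p - a - b)*a" using b by algebra
    show "r = a*b*(p - a - b)" using a b by algebra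
  qed
qed

text \<open>
  Some root \<open>x\<close> of the characteristic polynomial is off the unit circle. The roots are permuted by
  \<open>x \<mapsto> 1 / cnj x\<close>, so one of modulus greater than 1 exists, it comes with its mirror image, and the third
  root is determined by the product 1.
\<close>

lemma goldman_f_pos_eigenvalue:
  assumes "goldman_f z > 0"
  obtains m where "cmod m > 1" "z = m + cnj m / m + 1 / cnj m"
proof -
  obtain a b c where abc: "z = a + b + c" "cnj z = a*b + b*c + c*a" "1 = a*b*c"
    by (rule complex_cubic_roots)
  have root: "x^3 - z * x^2 + cnj z * x - 1 = 0" if "x \<in> {a, b, c}" for x
    unfolding abc(2) unfolding abc(1) using abc(3) that by (elim insertE emptyE; algebra)
  have "\<not> (cmod a = 1 \<and> cmod b = 1 \<and> cmod c = 1)"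
    using unit_roots_goldman_f[of z a b c] abc assms by auto
  then obtain x where x: "x^3 - z * x^2 + cnj z * x - 1 = 0" "cmod x \<noteq> 1"
    using root by blast
  have x0: "x \<noteq> 0" using x(1) by auto
  define y where "y = 1 / cnj x"
  have xy: "y * cnj x = 1" using x0 by (simp add: y_def)
  have "cnj x^3 - cnj z * cnj x^2 + z * cnj x - 1 = 0"
    using arg_cong[OF x(1), of cnj] by simp
  then have y: "y^3 - z * y^2 + cnj z * y - 1 = 0"
    using xy by algebra
  have cy: "cmod y = 1 / cmod x" by (simp add: y_def norm_divide)
  have "cmod x > 0" using x0 by simp
  obtain m where m: "cmod m > 1" "m^3 - z * m^2 + cnj z * m - 1 = 0"
  proof (cases "cmod x > 1")
    case True
    then show ?thesis using that x by blast
  next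
    case False
    then have "cmod y > 1" using x(2) cy \<open>cmod x > 0\<close> by simp
    then show ?thesis using that y by blast
  qed
  have m0: "m \<noteq> 0" using m(1) by auto
  define n where "n = 1 / cnj m"
  have mn: "n * cnj m = 1" using m0 by (simp add: n_def)
  have "cnj m^3 - cnj z * cnj m^2 + z * cnj m - 1 = 0"
    using arg_cong[OF m(2), of cnj] by simp
  then have n: "n^3 - z * n^2 + cnj z * n - 1 = 0"
    using mn by algebra
  have "cmod n < 1" using m(1) by (simp add: n_def norm_divide divide_less_eq)
  then have "m \<noteq> n" using m(1) by auto
  moreover have "(m - n) * (m * n + (z - m - n) * (m + n) - cnj z) = 0"
    using m(2) n by algebra
  ultimately have "cnj z = m * n + (z - m - n) * (m + n)"
    by simp
  then have "m * n * (z - m - n) = 1"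
    using m(2) by algebra
  then have "z - m - n = cnj m / m"
    using m0 by (simp add: n_def field_simps)
  then show thesis
    using that[OF m(1)] by (simp add: n_def algebra_simps)
qed


section \<open>Eigenframes\<close>

lemma SU_witt_eigenvector:
  assumes M: "M \<in> SU witt_form"
    and e: "e^3 - trace M * e^2 + cnj (trace M) * e - 1 = 0"
  obtains v where "v \<noteq> 0" "M *v v = e *s v"
proof -
  define N where "N = M - mat e"
  note m = SU_witt_entries(1-3)[OF M]
  have "det M = 1" using M by (simp add: SU_def)
  then have "det N = 0"
    using e m unfolding N_def trace_def sum_3 det_3
    by (simp add: mat_def) algebra
  then have "\<not> (\<forall>v. N *v v = 0 \<longrightarrow> v = 0)"
    using invertible_det_nz[of N] matrix_left_invertible_ker[of N] invertible_left_inverse[of N] by blast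
  then obtain v where v: "v \<noteq> 0" "N *v v = 0" by blast
  have "mat e *v v = e *s v"
    by (simp add: vec_eq_iff forall_3 matrix_vector_mult_def sum_3 mat_def)
  then have "M *v v = e *s v"
    using v(2) unfolding N_def by (simp add: matrix_vector_mult_diff_rdistrib)
  then show thesis using that v(1) by blast
qed

text \<open>
  Apply \<open>M\<close> twice to a linear relation; in each coordinate the three resulting equations form a
  Vandermonde system.
\<close>

lemma det_from_columns_eigenvectors:
  assumes eig: "M *v u = a *s u" "M *v v = b *s v" "M *v w = c *s w"
    and nz: "u \<noteq> 0" "v \<noteq> 0" "w \<noteq> 0" and dist: "a \<noteq> b" "b \<noteq> c" "c \<noteq> a"
  shows "det (from_columns u v w) \<noteq> 0"
proof -
  have "x = 0" if x: "from_columns u v w *v x = 0" for x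
  proof -
    let ?s = "x$1 *s u + x$2 *s v + x$3 *s w"
    have s: "?s = 0" using x by (simp add: from_columns_mult)
    have M_mult: "M *v (p *s u + q *s v + r *s w) = (p * a) *s u + (q * b) *s v + (r * c) *s w" for p q r
      by (simp add: matrix_vector_right_distrib vector_scalar_commute eig)
    have Ms: "(x$1 * a) *s u + (x$2 * b) *s v + (x$3 * c) *s w = 0"
      using M_mult[of "x$1" "x$2" "x$3"] by (simp add: s)
    have MMs: "(x$1 * a * a) *s u + (x$2 * b * b) *s v + (x$3 * c * c) *s w = 0"
      using M_mult[of "x$1 * a" "x$2 * b" "x$3 * c"] by (simp add: Ms)
    have "x$1 * u$i = 0 \<and> x$2 * v$i = 0 \<and> x$3 * w$i = 0" for i
    proof -
      have 1: "x$1 * u$i + x$2 * v$i + x$3 * w$i = 0"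
        "x$1 * a * u$i + x$2 * b * v$i + x$3 * c * w$i = 0"
        "x$1 * a * a * u$i + x$2 * b * b * v$i + x$3 * c * c * w$i = 0"
        using s Ms MMs by (simp_all add: vec_eq_iff)
      have "(a - b) * (c - a) * (x$1 * u$i) = 0" "(a - b) * (b - c) * (x$2 * v$i) = 0"
        "(c - a) * (b - c) * (x$3 * w$i) = 0"
        using 1 by algebra+
      then show ?thesis using dist by simp
    qed
    then show "x = 0" using nz by (auto simp: vec_eq_iff forall_3)
  qed
  then show ?thesis
    using invertible_det_nz matrix_left_invertible_ker invertible_left_inverse by blast
qed

lemma eigenvector_columns:
  assumes "M *v u = a *s u" "M *v v = b *s v" "M *v w = c *s w"
  shows "M ** from_columns u v w = from_columns u v w ** diag3 a b c"
proof -
  have "(M ** from_columns u v w) $ i $ 1 = (M *v u) $ i"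
    "(M ** from_columns u v w) $ i $ 2 = (M *v v) $ i"
    "(M ** from_columns u v w) $ i $ 3 = (M *v w) $ i" for i
    by (simp_all add: matrix_matrix_mult_def matrix_vector_mult_def)
  then show ?thesis
    by (simp add: vec_eq_iff forall_3 assms)
      (simp add: matrix_matrix_mult_def sum_3 diag3_def mult.commute)
qed

text \<open>
  The determinant of the antidiagonal form is -1. This is how the signature enters: a Gram matrix of
  a basis has negative determinant.
\<close>

lemma witt_gram_det:
  "det (vector [vector [witt_form u u, witt_form u v, witt_form u w],
                vector [witt_form v u, witt_form v v, witt_form v w],
                vector [witt_form w u, witt_form w v, witt_form w w]] :: complex ^ 3 ^ 3)
   = - (det (from_columns u v w) * cnj (det (from_columns u v w)))"
  unfolding det_3 witt_form_def by simp algebra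

lemma eigenvectors_orthogonal:
  assumes M: "M \<in> SU witt_form" and eig: "M *v u = a *s u" "M *v v = b *s v" and "a * cnj b \<noteq> 1"
  shows "witt_form u v = 0"
proof -
  have "witt_form (M *v u) (M *v v) = witt_form u v"
    using M by (simp add: SU_def)
  moreover have "witt_form (M *v u) (M *v v) = a * cnj b * witt_form u v"
    by (simp add: eig witt_form_def algebra_simps)
  ultimately show ?thesis using assms(4) by simp
qed

text \<open>
  The moduli of the eigenvalues leave only two possibly nonzero products of eigenvectors:
  \<open>k = witt_form u w\<close> and \<open>witt_form v v\<close>. The Gram determinant is \<open>- \<bar>k\<bar>\<^sup>2 witt_form v v\<close>; being
  negative, it forces \<open>k \<noteq> 0\<close> and \<open>witt_form v v > 0\<close>, so that \<open>v\<close> and \<open>w\<close> can be scaled.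
\<close>

lemma SU_witt_eigenframe:
  assumes M: "M \<in> SU witt_form" and "goldman_f (trace M) > 0"
  obtains Q m where "witt_frame witt_form Q" "cmod m > 1"
    "M ** Q = Q ** diag3 m (cnj m / m) (1 / cnj m)"
proof -
  obtain m where m: "cmod m > 1" and tr: "trace M = m + cnj m / m + 1 / cnj m"
    using goldman_f_pos_eigenvalue[OF assms(2)] by blast
  \<comment> \<open>With \<open>n\<close> in place of quotients the eigenvalues are polynomials in \<open>m\<close>, \<open>n\<close> and their conjugates.\<close>
  define n b c where "n = 1 / m" and "b = cnj m / m" and "c = 1 / cnj m"
  have m0: "m \<noteq> 0" using m by auto
  have nm: "m * n = 1" "cnj m * cnj n = 1" "b = cnj m * n" "c = cnj n" "cnj b = m * cnj n"
    using m0 by (simp_all add: n_def b_def c_def)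
  have char: "e^3 - trace M * e^2 + cnj (trace M) * e - 1 = 0" if "e \<in> {m, b, c}" for e
  proof -
    have "trace M = m + cnj m * n + cnj n" "cnj (trace M) = cnj m + m * cnj n + n"
      using tr by (simp_all add: nm(3,4) flip: b_def c_def)
    moreover have "e = m \<or> e = cnj m * n \<or> e = cnj n" using that nm by auto
    ultimately show ?thesis using nm(1,2) by (elim disjE; algebra)
  qed
  obtain u where u: "u \<noteq> 0" "M *v u = m *s u"
    using SU_witt_eigenvector[OF M char] by blast
  obtain v where v: "v \<noteq> 0" "M *v v = b *s v"
    using SU_witt_eigenvector[OF M char] by blast
  obtain w where w: "w \<noteq> 0" "M *v w = c *s w"
    using SU_witt_eigenvector[OF M char] by blast
  have "cmod b = 1" "cmod c < 1"
    using m0 m by (simp_all add: b_def c_def norm_divide divide_less_eq)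
  then have dist: "m \<noteq> b" "b \<noteq> c" "c \<noteq> m" using m by auto
  have "cmod c * cmod c < 1"
    using mult_left_mono[of "cmod c" 1 "cmod c"] \<open>cmod c < 1\<close> by simp
  then have unit: "cmod (m * cnj m) > 1" "cmod (m * cnj b) > 1" "cmod (b * cnj c) < 1" "cmod (c * cnj c) < 1"
    using m \<open>cmod b = 1\<close> \<open>cmod c < 1\<close>
    by (simp_all add: norm_mult less_1_mult)
  then have ne: "m * cnj m \<noteq> 1" "m * cnj b \<noteq> 1" "b * cnj c \<noteq> 1" "c * cnj c \<noteq> 1"
    by (metis norm_one less_irrefl)+
  have uu: "witt_form u u = 0" and uv: "witt_form u v = 0" and vw: "witt_form v w = 0"
    and ww: "witt_form w w = 0"
    using eigenvectors_orthogonal[OF M] u(2) v(2) w(2) ne by blast+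
  have herm: "witt_form y x = cnj (witt_form x y)" for x y
    using hermitian_witt_form unfolding hermitian_form_def by blast
  define D k where "D = det (from_columns u v w)" and "k = witt_form u w"
  have "D \<noteq> 0"
    unfolding D_def
    by (rule det_from_columns_eigenvectors[OF u(2) v(2) w(2) u(1) v(1) w(1) dist])
  have vu: "witt_form v u = 0" "witt_form w v = 0" and wu: "witt_form w u = cnj k"
    using herm[of u v] herm[of v w] herm[of u w] uv vw by (simp_all add: k_def)
  have "k * witt_form v v * cnj k = D * cnj D"
    using witt_gram_det[of u v w] unfolding D_def det_3 by (simp add: uu uv vw ww vu wu flip: k_def)
  then have vv: "complex_of_real ((cmod k)^2) * witt_form v v = complex_of_real ((cmod D)^2)"
    unfolding complex_norm_square by (simp add: mult_ac)
  have k0: "k \<noteq> 0" using vv \<open>D \<noteq> 0\<close> by auto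
  define r where "r = (cmod D)^2 / (cmod k)^2"
  have r: "witt_form v v = complex_of_real r" "r > 0"
    using vv k0 \<open>D \<noteq> 0\<close> by (simp_all add: r_def field_simps)
  define s where "s = complex_of_real (1 / sqrt r)"
  have "s * s = complex_of_real (1 / sqrt r * (1 / sqrt r))"
    unfolding s_def of_real_mult ..
  then have s: "s * s * complex_of_real r = 1" "cnj s = s"
    using r(2) by (simp_all add: s_def field_simps flip: of_real_mult)
  let ?Q = "from_columns u (s *s v) ((1 / cnj k) *s w)"
  have "witt_frame witt_form ?Q"
  proof (rule witt_frame_columnsI[OF hermitian_witt_form])
    have scale: "witt_form (p *s x) y = p * witt_form x y"
      "witt_form x (q *s y) = cnj q * witt_form x y" for p q x y
      by (simp_all add: witt_form_def algebra_simps)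
    show "witt_form u u = 0" "witt_form u (s *s v) = 0" "witt_form u ((1 / cnj k) *s w) = 1"
      "witt_form (s *s v) (s *s v) = 1" "witt_form (s *s v) ((1 / cnj k) *s w) = 0"
      "witt_form ((1 / cnj k) *s w) ((1 / cnj k) *s w) = 0"
      using k0 s(1) by (simp_all add: scale uu uv vw ww r(1) s(2) mult.assoc flip: k_def)
  qed
  moreover have "M ** ?Q = ?Q ** diag3 m b c"
    using u(2) v(2) w(2)
    by (intro eigenvector_columns) (simp_all add: vector_scalar_commute mult.commute)
  ultimately show thesis
    using that m by (simp add: b_def c_def)
qed


lemma SU_eigenframe:
  assumes "hermitian_form h" "signature_2_1 h" and A: "A \<in> SU h" and f: "goldman_f (trace A) > 0"
  obtains P R m where "witt_frame h P" "P ** R = mat 1" "R ** P = mat 1" "cmod m > 1"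
    "A = P ** diag3 m (cnj m / m) (1 / cnj m) ** R"
proof -
  obtain P0 where P0: "witt_frame h P0" using witt_frame_exists assms(1,2) .
  obtain R0 where R0: "P0 ** R0 = mat 1" "R0 ** P0 = mat 1" using witt_frame_inverse[OF P0] .
  define M where "M = R0 ** A ** P0"
  have "P0 ** M ** R0 = (P0 ** R0) ** A ** (P0 ** R0)"
    by (simp only: M_def matrix_mul_assoc)
  then have AM: "A = P0 ** M ** R0" by (simp add: R0)
  then have "M \<in> SU witt_form" using SU_conjugate[OF P0 R0] A by simp
  moreover have "trace M = trace A"
    using trace_mul_sym[of "P0 ** M" R0] by (simp add: AM matrix_mul_assoc R0)
  ultimately obtain Q m where Q: "witt_frame witt_form Q" and m: "cmod m > 1"
    and MQ: "M ** Q = Q ** diag3 m (cnj m / m) (1 / cnj m)"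
    using SU_witt_eigenframe[of M] f by metis
  obtain T where T: "Q ** T = mat 1" "T ** Q = mat 1" using witt_frame_inverse[OF Q] .
  show thesis
  proof (rule that)
    show "witt_frame h (P0 ** Q)"
      using P0 Q by (simp add: witt_frame_def flip: matrix_vector_mul_assoc)
    have "(P0 ** Q) ** (T ** R0) = P0 ** (Q ** T) ** R0"
      by (simp only: matrix_mul_assoc)
    then show "(P0 ** Q) ** (T ** R0) = mat 1" by (simp add: T R0)
    have "(T ** R0) ** (P0 ** Q) = T ** (R0 ** P0) ** Q"
      by (simp only: matrix_mul_assoc)
    then show "(T ** R0) ** (P0 ** Q) = mat 1" by (simp add: T R0)
    have "(P0 ** Q) ** diag3 m (cnj m / m) (1 / cnj m) ** (T ** R0) = P0 ** (M ** Q) ** T ** R0"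
      by (simp only: MQ matrix_mul_assoc)
    also have "\<dots> = P0 ** M ** (Q ** T) ** R0"
      by (simp only: matrix_mul_assoc)
    finally show "A = (P0 ** Q) ** diag3 m (cnj m / m) (1 / cnj m) ** (T ** R0)"
      by (simp add: T AM)
  qed (fact m)
qed

section \<open>Positive values of the discriminant and loxodromic maps\<close>

lemma line_map_span: "line_map A (vec.span {v}) = vec.span {A *v v}"
  unfolding line_map_def vec.span_singleton by (simp add: image_image vector_scalar_commute)

lemma span_singleton_eqD:
  fixes u v :: "complex ^ 3"
  assumes "vec.span {u} = vec.span {v}"
  obtains k where "u = k *s v"
  using assms vec.span_base[of u "{u}"] unfolding vec.span_singleton by auto

lemma span_singleton_scale:
  fixes v :: "complex ^ 3"
  assumes "k \<noteq> 0"
  shows "vec.span {k *s v} = vec.span {v}"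
proof -
  have "x *s v \<in> range (\<lambda>y. (y * k) *s v)" for x
    by (rule range_eqI[of _ _ "x / k"]) (use assms in simp)
  then show ?thesis
    unfolding vec.span_singleton by auto
qed

text \<open>
  A fixed line is spanned by an eigenvector, and as the eigenvalues are distinct it is one of the
  three lines of the eigenframe. Two of these are null and one is positive, so none is a
  point of the hyperbolic plane and exactly two are boundary points.
\<close>

lemma goldman_f_pos_imp_loxodromic:
  assumes h: "hermitian_form h" "signature_2_1 h" and A: "A \<in> SU h" and f: "goldman_f (trace A) > 0"
  shows "loxodromic h A"
proof -
  obtain P R m where P: "witt_frame h P" and R: "P ** R = mat 1" "R ** P = mat 1"
    and m: "cmod m > 1" and AP: "A = P ** diag3 m (cnj m / m) (1 / cnj m) ** R"
    using SU_eigenframe[OF h A f] .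
  have m0: "m \<noteq> 0" using m by auto
  define b c where "b = cnj m / m" and "c = 1 / cnj m"
  have "cmod b = 1" "cmod c < 1" "c \<noteq> 0"
    using m0 m by (simp_all add: b_def c_def norm_divide divide_less_eq)
  then have dist: "m \<noteq> b" "b \<noteq> c" "c \<noteq> m" using m by auto
  have PR: "P *v (R *v v) = v" "R *v (P *v v) = v" for v
    by (simp_all add: matrix_vector_mul_assoc R)
  have APx: "A *v (P *v x) = P *v vector [m * x$1, b * x$2, c * x$3]" for x
    by (simp add: AP PR diag3_mult b_def c_def flip: matrix_vector_mul_assoc)
  have hP: "h (P *v x) (P *v y) = witt_form x y" for x y
    using P by (simp add: witt_frame_def)
  have P0: "P *v x = 0 \<longleftrightarrow> x = 0" for x
    using witt_frame_kernel[OF P] by auto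
  define p q where "p = vec.span {P *v axis 1 1}" and "q = vec.span {P *v axis 3 1}"
  have fixed: "(\<exists>k. x = k *s axis 1 1) \<or> (\<exists>k. x = k *s axis 2 1) \<or> (\<exists>k. x = k *s axis 3 1)"
    if "line_map A (vec.span {P *v x}) = vec.span {P *v x}" for x
  proof -
    obtain k where "A *v (P *v x) = k *s (P *v x)"
      using \<open>line_map A _ = _\<close> span_singleton_eqD unfolding line_map_span by metis
    then have "P *v (vector [m * x$1, b * x$2, c * x$3] - k *s x) = 0"
      by (simp add: APx matrix_vector_mult_diff_distrib vector_scalar_commute)
    then have "vector [m * x$1, b * x$2, c * x$3] - k *s x = 0"
      by (simp only: P0)
    then have "(m - k) * x$1 = 0" "(b - k) * x$2 = 0" "(c - k) * x$3 = 0"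
      by (simp_all add: vec_eq_iff forall_3 algebra_simps)
    then consider "x$2 = 0 \<and> x$3 = 0" | "x$1 = 0 \<and> x$3 = 0" | "x$1 = 0 \<and> x$2 = 0"
      using dist by auto
    then show ?thesis
    proof cases
      case 1
      then have "x = x$1 *s axis 1 1" by (simp add: vec_eq_iff forall_3 axis_def)
      then show ?thesis by blast
    next
      case 2
      then have "x = x$2 *s axis 2 1" by (simp add: vec_eq_iff forall_3 axis_def)
      then show ?thesis by blast
    next
      case 3
      then have "x = x$3 *s axis 3 1" by (simp add: vec_eq_iff forall_3 axis_def)
      then show ?thesis by blast
    qed
  qed
  have form_axis: "witt_form (k *s axis 1 1) (k *s axis 1 1) = 0"
      "witt_form (k *s axis 2 1) (k *s axis 2 1) = complex_of_real ((cmod k)^2)"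
      "witt_form (k *s axis 3 1) (k *s axis 3 1) = 0" for k
    by (simp_all only: complex_norm_square) (simp_all add: witt_form_def axis_def)
  have "line_map A L \<noteq> L" if "L \<in> hyperbolic_plane h" for L
  proof
    assume L: "line_map A L = L"
    obtain v where v: "L = vec.span {v}" "Re (h v v) < 0"
      using \<open>L \<in> _\<close> unfolding hyperbolic_plane_def by blast
    define x where "x = R *v v"
    have x: "v = P *v x" by (simp add: x_def PR)
    have "Re (witt_form x x) \<ge> 0"
      using fixed[of x] L v(1) form_axis unfolding x by auto
    then show False using v(2) by (simp add: x hP)
  qed
  moreover have "{L \<in> hyperbolic_boundary h. line_map A L = L} = {p, q}"
  proof (intro equalityI subsetI)
    fix L assume "L \<in> {L \<in> hyperbolic_boundary h. line_map A L = L}"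
    then obtain v where L: "line_map A L = L" and v: "L = vec.span {v}" "v \<noteq> 0" "h v v = 0"
      unfolding hyperbolic_boundary_def by blast
    define x where "x = R *v v"
    have x: "v = P *v x" by (simp add: x_def PR)
    have "witt_form x x = 0" "x \<noteq> 0" using v(2,3) by (auto simp: x hP)
    then have "(\<exists>k. k \<noteq> 0 \<and> x = k *s axis 1 1) \<or> (\<exists>k. k \<noteq> 0 \<and> x = k *s axis 3 1)"
      using fixed[of x] L v(1) form_axis unfolding x by fastforce
    then show "L \<in> {p, q}"
      by (auto simp: v(1) x p_def q_def vector_scalar_commute span_singleton_scale)
  next
    fix L assume "L \<in> {p, q}"
    have ax: "axis 1 1 \<noteq> (0 :: complex ^ 3)" "axis 3 1 \<noteq> (0 :: complex ^ 3)"
      by (simp_all add: axis_eq_0_iff)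
    have "p \<in> hyperbolic_boundary h" "q \<in> hyperbolic_boundary h"
      unfolding hyperbolic_boundary_def p_def q_def
      using ax form_axis(1,3)[of 1] P0 hP by (auto intro!: exI)
    moreover have "A *v (P *v axis 1 1) = m *s (P *v axis 1 1)" "A *v (P *v axis 3 1) = c *s (P *v axis 3 1)"
      unfolding APx vector_scalar_commute[symmetric]
      by (rule arg_cong[of _ _ "(*v) P"]; simp add: vec_eq_iff forall_3 axis_def)+
    then have "line_map A p = p" "line_map A q = q"
      using m0 \<open>c \<noteq> 0\<close> by (simp_all add: p_def q_def line_map_span span_singleton_scale)
    ultimately show "L \<in> {L \<in> hyperbolic_boundary h. line_map A L = L}"
      using \<open>L \<in> {p, q}\<close> by blast
  qed
  moreover have "p \<noteq> q"
  proof
    assume "p = q"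
    then obtain k where "P *v axis 1 1 = k *s (P *v axis 3 1)"
      unfolding p_def q_def by (rule span_singleton_eqD)
    then have "P *v (axis 1 1 - k *s axis 3 1) = 0"
      by (simp add: matrix_vector_mult_diff_distrib vector_scalar_commute)
    then have "axis 1 1 - k *s axis 3 1 = (0 :: complex ^ 3)" by (simp only: P0)
    then show False by (simp add: vec_eq_iff forall_3 axis_def)
  qed
  ultimately show ?thesis by (simp add: loxodromic_def)
qed


section \<open>The polynomial Q in terms of the diagonal\<close>

text \<open>
  Here \<open>a, b, c\<close> are the entries of a diagonal matrix \<open>A\<close>, and the \<open>d\<close>'s and \<open>f\<close>'s are the diagonals of
  a matrix \<open>B\<close> and of its inverse, where \<open>A\<close> and \<open>B\<close> have determinant 1. The polynomials \<open>S\<close> and \<open>P\<close> are the sum and the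
  product of the traces of the commutator of \<open>A\<close>, \<open>B\<close> and of its inverse, so \<open>Q\<close> is the
  square of the difference \<open>\<delta>\<close> of these traces. As \<open>A\<close> is diagonal, \<open>\<delta>\<close> is up to sign the Vandermonde product of
  \<open>a, b, c\<close> times \<open>B\<^sub>1\<^sub>2 B\<^sub>2\<^sub>3 B\<^sub>3\<^sub>1 - B\<^sub>1\<^sub>3 B\<^sub>3\<^sub>2 B\<^sub>2\<^sub>1\<close>, and the square of the second factor can be
  written in the diagonals. This explains the factorisation, which holds as a polynomial identity.
\<close>

lemma poly_Q_spectral:
  fixes a b c d1 d2 d3 f1 f2 f3 :: complex
  assumes "a * b * c = 1"
  shows "poly_Q (a + b + c) (d1 + d2 + d3) (a*d1 + b*d2 + c*d3) (b*c*d1 + c*a*d2 + a*b*d3)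
           (a*b + b*c + c*a) (f1 + f2 + f3) (b*c*f1 + c*a*f2 + a*b*f3) (a*f1 + b*f2 + c*f3)
     = ((a - b) * (b - c) * (c - a))^2 * (1 + 4 * (d1*d2*d3 + f1*f2*f3)
         - 2 * (d1*f1 + d2*f2 + d3*f3) + (d1*f1 + d2*f2 + d3*f3)^2
         - 4 * (d1*f1*d2*f2 + d1*f1*d3*f3 + d2*f2*d3*f3))"
  using assms unfolding poly_Q_def poly_S_def poly_P_def by algebra

text \<open>
  For a unitary \<open>B\<close> the inverse has the diagonal \<open>cnj d3, cnj d2, cnj d1\<close>; the second factor is then a
  difference of two squares, and the squared Vandermonde product is the discriminant \<open>goldman_f z\<close>.
\<close>

lemma poly_Q_diagonal:
  fixes m d1 d2 d3 :: complex
  defines "b \<equiv> cnj m / m" and "c \<equiv> 1 / cnj m"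
  assumes "m \<noteq> 0" and z: "z = m + b + c"
    and t: "zB = d1 + d2 + d3" "zAB = m * d1 + b * d2 + c * d3"
      "zAiB = 1 / m * d1 + 1 / b * d2 + 1 / c * d3"
  shows "poly_Q z zB zAB zAiB (cnj z) (cnj zB) (cnj zAB) (cnj zAiB) =
    complex_of_real (goldman_f z *
      ((1 + (cmod d2)^2 - 2 * Re (d1 * cnj d3))^2 - 4 * (cmod (d1 * d3 - cnj d2))^2))"
proof -
  have abc: "m * b * c = 1" and inv: "1 / m = b * c" "1 / b = c * m" "1 / c = m * b"
    and cnjs: "cnj m = m * b" "cnj b = c * m" "cnj c = b * c"
    using \<open>m \<noteq> 0\<close> by (simp_all add: b_def c_def field_simps)
  have cz: "cnj z = m * b + b * c + c * m"
    by (simp add: z cnjs)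
  have "poly_Q z zB zAB zAiB (cnj z) (cnj zB) (cnj zAB) (cnj zAiB) =
    poly_Q (m + b + c) (d1 + d2 + d3) (m*d1 + b*d2 + c*d3) (b*c*d1 + c*m*d2 + m*b*d3)
           (m*b + b*c + c*m) (cnj d3 + cnj d2 + cnj d1)
           (b*c*cnj d3 + c*m*cnj d2 + m*b*cnj d1) (m*cnj d3 + b*cnj d2 + c*cnj d1)"
  proof -
    have cB: "cnj zB = cnj d3 + cnj d2 + cnj d1"
      and cAB: "cnj zAB = b*c*cnj d3 + c*m*cnj d2 + m*b*cnj d1"
      by (simp_all add: t cnjs)
    have AiB: "zAiB = b*c*d1 + c*m*d2 + m*b*d3"
      by (simp add: t(3) inv)
    have cAiB: "cnj zAiB = m*cnj d3 + b*cnj d2 + c*cnj d1"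
      using abc by (simp add: t(3) inv cnjs) algebra
    show ?thesis
      unfolding cz cB cAB cAiB unfolding z t(1,2) AiB ..
  qed
  also have "\<dots> = complex_of_real (goldman_f z) *
      ((1 + d2 * cnj d2 - (d1 * cnj d3 + d3 * cnj d1))^2
        - 4 * ((d1 * d3 - cnj d2) * (cnj d1 * cnj d3 - d2)))"
    unfolding poly_Q_spectral[OF abc] goldman_f_discriminant[OF z cz abc] by algebra
  also have "d1 * cnj d3 + d3 * cnj d1 = complex_of_real (2 * Re (d1 * cnj d3))"
    using complex_add_cnj[of "d1 * cnj d3"] by (simp add: mult.commute)
  also have "(d1 * d3 - cnj d2) * (cnj d1 * cnj d3 - d2) = complex_of_real ((cmod (d1 * d3 - cnj d2))^2)"
    unfolding complex_norm_square by simp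
  also have "d2 * cnj d2 = complex_of_real ((cmod d2)^2)"
    unfolding complex_norm_square ..
  finally show ?thesis by simp
qed

section \<open>Diagonals of special unitary matrices\<close>

text \<open>
  The bound is \<open>\<bar>Re (M $ 3 $ 1 * cnj (M $ 1 $ 3))\<bar> \<le> cmod (M $ 1 $ 3 * M $ 3 $ 1)\<close>, expressed in
  the diagonal entries.
\<close>

lemma SU_witt_diagonal_inequality:
  assumes M: "M \<in> SU witt_form"
  shows "\<bar>1 + (cmod (M$2$2))^2 - 2 * Re (M$1$1 * cnj (M$3$3))\<bar>
    \<le> 2 * cmod (M$1$1 * M$3$3 - cnj (M$2$2))"
proof -
  note m = SU_witt_entries[OF M]
  have "Re (M$2$3 * cnj (M$2$1)) = Re (M$2$1 * cnj (M$2$3))"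
    by simp
  moreover have "(cmod (M$2$2))^2 = Re (M$2$2 * cnj (M$2$2))"
    by (simp flip: complex_norm_square)
  ultimately have "1 + (cmod (M$2$2))^2 - 2 * Re (M$1$1 * cnj (M$3$3)) = 2 * Re (M$3$1 * cnj (M$1$3))"
    using arg_cong[OF m(4), of Re] arg_cong[OF m(5), of Re]
    unfolding plus_complex.sel one_complex.sel by linarith
  also have "\<bar>\<dots>\<bar> \<le> 2 * cmod (M$3$1 * cnj (M$1$3))"
    using abs_Re_le_cmod[of "M$3$1 * cnj (M$1$3)"] by simp
  also have "cmod (M$3$1 * cnj (M$1$3)) = cmod (M$1$3 * M$3$1)"
    by (simp add: norm_mult)
  also have "M$1$3 * M$3$1 = M$1$1 * M$3$3 - cnj (M$2$2)"
    by (simp flip: m(2))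
  finally show ?thesis .
qed

text \<open>
  The outer two columns are \<open>(d1, p, s)\<close> and \<open>(r, q, d3)\<close>. The first three assumptions say that they are
  null and have product 1; the middle column is then their conjugate cross product, and
  the fourth assumption says that its middle entry is \<open>d2\<close>. Its norm is 1 by the Lagrange identity for the
  cross product.
\<close>

lemma SU_witt_from_corner_columns:
  fixes d1 d2 d3 p q r s :: complex
  assumes "d1 * cnj s + p * cnj p + s * cnj d1 = 0"
    and "r * cnj d3 + q * cnj q + d3 * cnj r = 0"
    and "d1 * cnj d3 + p * cnj q + s * cnj r = 1"
    and "r * s = d1 * d3 - cnj d2"
  shows "\<exists>M \<in> SU witt_form. M$1$1 = d1 \<and> M$2$2 = d2 \<and> M$3$3 = d3"
proof -
  define x y where "x = r * p - d1 * q" and "y = q * s - p * d3"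
  define u v w :: "complex ^ 3"
    where "u = vector [d1, p, s]" and "v = vector [cnj x, d2, cnj y]" and "w = vector [r, q, d3]"
  have conj: "cnj d1 * d3 + cnj p * q + cnj s * r = 1"
    using arg_cong[OF assms(3), of cnj] by simp
  have cxy: "cnj x = cnj r * cnj p - cnj d1 * cnj q" "cnj y = cnj q * cnj s - cnj p * cnj d3"
    and d2: "d2 = cnj d1 * cnj d3 - cnj r * cnj s"
    using arg_cong[OF assms(4), of cnj] by (simp_all add: x_def y_def)
  have cd2: "cnj d2 = d1 * d3 - r * s" using assms(4) by simp
  have "cnj x * y + d2 * cnj d2 + cnj y * x =
      (d1 * cnj d3 + p * cnj q + s * cnj r) * (cnj d1 * d3 + cnj p * q + cnj s * r)
      - (d1 * cnj s + p * cnj p + s * cnj d1) * (r * cnj d3 + q * cnj q + d3 * cnj r)"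
    unfolding cxy cd2 unfolding x_def y_def d2 by algebra
  then have vv: "cnj x * y + d2 * cnj d2 + cnj y * x = 1"
    by (simp only: assms(1-3) conj) simp
  have "witt_frame witt_form (from_columns u v w)"
  proof (rule witt_frame_columnsI[OF hermitian_witt_form])
    show "witt_form u u = 0" "witt_form w w = 0" "witt_form u w = 1"
      using assms(1-3) by (simp_all add: witt_form_def u_def w_def)
    show "witt_form v v = 1"
      using vv by (simp add: witt_form_def v_def)
    show "witt_form u v = 0"
      by (simp add: witt_form_def u_def v_def cd2) (simp add: x_def y_def algebra_simps)
    have "witt_form w v = 0"
      by (simp add: witt_form_def w_def v_def cd2) (simp add: x_def y_def algebra_simps)
    then show "witt_form v w = 0"
      using hermitian_witt_form unfolding hermitian_form_def by (metis complex_cnj_zero)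
  qed
  moreover have "det (from_columns u v w) = 1"
    using vv cd2 unfolding det_3 by (simp add: u_def v_def w_def) (simp only: x_def y_def; algebra)
  ultimately have "from_columns u v w \<in> SU witt_form"
    by (simp add: SU_def witt_frame_def)
  moreover have "from_columns u v w $ 1 $ 1 = d1" "from_columns u v w $ 2 $ 2 = d2"
    "from_columns u v w $ 3 $ 3 = d3"
    by (simp_all add: u_def v_def w_def)
  ultimately show ?thesis by blast
qed


lemma ex_product_with_norms:
  fixes w :: complex and \<alpha> \<beta> :: real
  assumes "\<alpha> \<ge> 0" "\<beta> \<ge> 0" "\<alpha> * \<beta> = (cmod w)^2"
  obtains p q where "p * cnj p = complex_of_real \<alpha>" "q * cnj q = complex_of_real \<beta>" "p * cnj q = w"
proof (cases "\<alpha> = 0")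
  case True
  then show thesis
    using assms that[of 0 "complex_of_real (sqrt \<beta>)"] by (simp flip: of_real_mult)
next
  case False
  define a where "a = complex_of_real (sqrt \<alpha>)"
  have "a * a = complex_of_real (sqrt \<alpha> * sqrt \<alpha>)"
    unfolding a_def of_real_mult ..
  then have a: "a * a = complex_of_real \<alpha>" "cnj a = a" "a \<noteq> 0"
    using assms(1) False by (simp_all add: a_def)
  show thesis
  proof (rule that)
    show "a * cnj a = complex_of_real \<alpha>" by (simp add: a)
    show "a * cnj (cnj w / a) = w" using a by simp
    have "cnj w / a * cnj (cnj w / a) = w * cnj w / (a * a)" by (simp add: a)
    also have "\<dots> = complex_of_real (\<alpha> * \<beta>) / complex_of_real \<alpha>"
      unfolding assms(3) a complex_norm_square ..
    finally show "cnj w / a * cnj (cnj w / a) = complex_of_real \<beta>" using False by simp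
  qed
qed

text \<open>
  The complex number \<open>m\<close> with modulus \<open>cmod y\<close> and real part \<open>t\<close> is the intended value of \<open>r * cnj s\<close> in the
  notation of \<open>SU_witt_from_corner_columns\<close>. Up to conjugation by a diagonal matrix \<open>s\<close> is a unit \<open>\<omega>\<close>, so
  \<open>r = y * cnj \<omega>\<close>, and \<open>m = y * (cnj \<omega>)\<^sup>2\<close> determines \<open>\<omega>\<close> up to sign. It remains to find \<open>p\<close> and \<open>q\<close>
  with prescribed squared moduli \<open>\<alpha>\<close>, \<open>\<beta>\<close> and prescribed product \<open>w = p * cnj q\<close>. This is possible if
  \<open>\<alpha> * \<beta> = (cmod w)\<^sup>2\<close>, which is what the choice of \<open>m\<close> guarantees, and if \<open>\<alpha>\<close> and \<open>\<beta>\<close>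
  are nonnegative, which is arranged by the sign of \<open>\<omega>\<close>.
\<close>

lemma ex_SU_witt_diagonal:
  fixes d1 d2 d3 :: complex
  assumes ineq: "\<bar>1 + (cmod d2)^2 - 2 * Re (d1 * cnj d3)\<bar> \<le> 2 * cmod (d1 * d3 - cnj d2)"
  shows "\<exists>M \<in> SU witt_form. M$1$1 = d1 \<and> M$2$2 = d2 \<and> M$3$3 = d3"
proof -
  define y where "y = d1 * d3 - cnj d2"
  define t where "t = (1 + (cmod d2)^2 - 2 * Re (d1 * cnj d3)) / 2"
  define m where "m = Complex t (sqrt ((cmod y)^2 - t^2))"
  have cy: "cnj y = cnj d1 * cnj d3 - d2" by (simp add: y_def)
  have "\<bar>t\<bar> \<le> cmod y" using ineq by (simp add: t_def y_def)
  then have "t^2 \<le> (cmod y)^2" using power_mono[of "\<bar>t\<bar>" "cmod y" 2] by simp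
  then have norm_m: "cmod m = cmod y"
    by (simp add: m_def cmod_def)
  then have mm: "m * cnj m = y * cnj y"
    by (metis complex_norm_square)
  have "m + cnj m = complex_of_real (2 * t)"
    by (simp add: complex_add_cnj m_def)
  also have "2 * t = 1 + (cmod d2)^2 - 2 * Re (d1 * cnj d3)" by (simp add: t_def)
  also have "complex_of_real \<dots> =
      1 + complex_of_real ((cmod d2)^2) - complex_of_real (2 * Re (d1 * cnj d3))"
    by simp
  also have "\<dots> = 1 + d2 * cnj d2 - (d1 * cnj d3 + cnj d1 * d3)"
    unfolding complex_norm_square complex_add_cnj[symmetric] by simp
  finally have tr_m: "m + cnj m = 1 + d2 * cnj d2 - (d1 * cnj d3 + cnj d1 * d3)" .
  show ?thesis
  proof (cases "y = 0")
    case True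
    \<comment> \<open>Now \<open>\<bar>1 - d1 * cnj d3\<bar>\<^sup>2 = 2 * t = 0\<close>, and the matrix can be taken diagonal.\<close>
    then have "m = 0" using norm_m by simp
    have "(1 - d1 * cnj d3) * cnj (1 - d1 * cnj d3) = 0"
      using tr_m \<open>m = 0\<close> \<open>y = 0\<close> y_def cy by simp algebra
    then have "1 - d1 * cnj d3 = 0"
      unfolding mult_eq_0_iff complex_cnj_zero_iff by blast
    then have "d1 * cnj d3 = 1" by simp
    then show ?thesis
      using SU_witt_from_corner_columns[of d1 0 0 0 d3 0 d2] True by (simp add: y_def)
  next
    case False
    define \<omega>\<^sub>0 where "\<omega>\<^sub>0 = csqrt (cnj m / cnj y)"
    define \<alpha> \<beta> where "\<alpha> \<omega> = - (2 * Re (d1 * cnj \<omega>))" and "\<beta> \<omega> = - (2 * Re (y * cnj \<omega> * cnj d3))"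
      for \<omega>
    define w where "w = 1 - d1 * cnj d3 - cnj m"
    have \<alpha>: "complex_of_real (\<alpha> \<omega>) = - (d1 * cnj \<omega> + cnj d1 * \<omega>)" for \<omega>
      using complex_add_cnj[of "d1 * cnj \<omega>"] by (simp add: \<alpha>_def)
    have \<beta>: "complex_of_real (\<beta> \<omega>) = - (y * cnj \<omega> * cnj d3 + cnj y * \<omega> * d3)" for \<omega>
      using complex_add_cnj[of "y * cnj \<omega> * cnj d3"] by (simp add: \<beta>_def)
    have sq0: "\<omega>\<^sub>0^2 = cnj m / cnj y" by (simp add: \<omega>\<^sub>0_def)
    have "cmod (\<omega>\<^sub>0^2) = 1" using norm_m False by (simp add: sq0 norm_divide)
    then have unit0: "cmod \<omega>\<^sub>0 = 1" by (simp add: norm_power power2_eq_1_iff)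
        (metis norm_ge_zero not_one_le_zero neg_0_le_iff_le)
    have \<alpha>\<beta>: "\<alpha> \<omega> * \<beta> \<omega> = (cmod w)^2" if "\<omega> * cnj \<omega> = 1" "\<omega>^2 * cnj y = cnj m" for \<omega>
    proof -
      have conj: "cnj \<omega>^2 * y = m" using arg_cong[OF that(2), of cnj] by simp
      have "complex_of_real (\<alpha> \<omega> * \<beta> \<omega>) =
          (d1 * cnj \<omega> + cnj d1 * \<omega>) * (y * cnj \<omega> * cnj d3 + cnj y * \<omega> * d3)"
        unfolding of_real_mult \<alpha> \<beta> by algebra
      also have "\<dots> = d1 * cnj d3 * (cnj \<omega>^2 * y) + cnj d1 * d3 * (\<omega>^2 * cnj y)
          + (\<omega> * cnj \<omega>) * (d1 * d3 * cnj y + cnj d1 * cnj d3 * y)"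
        by algebra
      also have "\<dots> = d1 * cnj d3 * m + cnj d1 * d3 * cnj m + d1 * d3 * cnj y + cnj d1 * cnj d3 * y"
        unfolding conj that by simp
      also have "\<dots> = (1 - d1 * cnj d3 - cnj m) * (1 - cnj d1 * d3 - m)"
        using mm tr_m y_def cy by algebra
      also have "\<dots> = w * cnj w" by (simp add: w_def)
      finally show ?thesis unfolding complex_norm_square[symmetric] of_real_eq_iff .
    qed
    have good0: "\<omega>\<^sub>0 * cnj \<omega>\<^sub>0 = 1" "\<omega>\<^sub>0^2 * cnj y = cnj m"
      using unit0 False complex_norm_square[of \<omega>\<^sub>0] by (simp_all add: sq0)
    have "\<alpha> (- \<omega>\<^sub>0) = - \<alpha> \<omega>\<^sub>0" "\<beta> (- \<omega>\<^sub>0) = - \<beta> \<omega>\<^sub>0" by (simp_all add: \<alpha>_def \<beta>_def)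
    moreover have "\<alpha> \<omega>\<^sub>0 * \<beta> \<omega>\<^sub>0 \<ge> 0" using \<alpha>\<beta>[OF good0] by simp
    ultimately obtain \<omega> where \<omega>: "\<omega> \<in> {\<omega>\<^sub>0, - \<omega>\<^sub>0}" "\<alpha> \<omega> \<ge> 0" "\<beta> \<omega> \<ge> 0"
      unfolding zero_le_mult_iff by fastforce
    have good: "\<omega> * cnj \<omega> = 1" "\<omega>^2 * cnj y = cnj m"
      using \<omega>(1) good0 by auto
    obtain p q where pq: "p * cnj p = complex_of_real (\<alpha> \<omega>)" "q * cnj q = complex_of_real (\<beta> \<omega>)"
      "p * cnj q = w"
      using ex_product_with_norms[OF \<omega>(2,3) \<alpha>\<beta>[OF good]] .
    show ?thesis
    proof (rule SU_witt_from_corner_columns)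
      show "d1 * cnj \<omega> + p * cnj p + \<omega> * cnj d1 = 0"
        unfolding pq \<alpha> by simp
      show "(y * cnj \<omega>) * cnj d3 + q * cnj q + d3 * cnj (y * cnj \<omega>) = 0"
        unfolding pq \<beta> by simp
      show "d1 * cnj d3 + p * cnj q + \<omega> * cnj (y * cnj \<omega>) = 1"
        using good(2) unfolding pq w_def by (simp add: power2_eq_square algebra_simps)
      show "(y * cnj \<omega>) * \<omega> = d1 * d3 - cnj d2"
        using good(1) unfolding y_def by algebra
    qed
  qed
qed

section \<open>The trace criterion\<close>

text \<open>
  The equations are linear in the unknowns, with a determinant that is up to sign the Vandermonde
  product of \<open>a, b, c\<close> because \<open>a * b * c = 1\<close>; the solution below is Cramer's rule.
\<close>

lemma interpolate_diagonal:
  fixes a b c :: complex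
  assumes "a \<noteq> b" "b \<noteq> c" "c \<noteq> a" "a * b * c = 1"
  obtains d1 d2 d3 where "x = d1 + d2 + d3" "y = a * d1 + b * d2 + c * d3"
    "w = 1 / a * d1 + 1 / b * d2 + 1 / c * d3"
proof -
  have inv: "1 / a = b * c" "1 / b = c * a" "1 / c = a * b"
    using assms(4) by (auto simp: eq_divide_eq divide_eq_eq mult_ac)
  define D where "D = (a - b) * (b - c) * (c - a)"
  have D: "D \<noteq> 0" using assms by (simp add: D_def)
  define d1 d2 d3 where "d1 = (c - b) * (w + a * y - a * (b + c) * x) / D"
    and "d2 = (a - c) * (w + b * y - b * (c + a) * x) / D"
    and "d3 = (b - a) * (w + c * y - c * (a + b) * x) / D"
  have "D * d1 = (c - b) * (w + a * y - a * (b + c) * x)"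
    "D * d2 = (a - c) * (w + b * y - b * (c + a) * x)"
    "D * d3 = (b - a) * (w + c * y - c * (a + b) * x)"
    using D by (simp_all add: d1_def d2_def d3_def)
  then have "D * (d1 + d2 + d3) = D * x" "D * (a * d1 + b * d2 + c * d3) = D * y"
    "D * (b * c * d1 + c * a * d2 + a * b * d3) = D * w"
    unfolding D_def using assms(4) by algebra+
  then have "x = d1 + d2 + d3" "y = a * d1 + b * d2 + c * d3"
    "w = b * c * d1 + c * a * d2 + a * b * d3"
    using D by simp_all
  then show thesis
    using that inv by simp
qed

theorem theorem5p2:
  fixes h :: "complex ^ 3 \<Rightarrow> complex ^ 3 \<Rightarrow> complex"
    and zA zB zAB zAiB :: complex
  assumes "hermitian_form h" and "signature_2_1 h"
    and "goldman_f zA > 0" and "goldman_f zB > 0"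
  shows "(\<exists>A B. A \<in> SU h \<and> B \<in> SU h \<and> loxodromic h A \<and> loxodromic h B \<and>
            trace A = zA \<and> trace B = zB \<and>
            trace (A ** B) = zAB \<and> trace (matrix_inv A ** B) = zAiB)
         \<longleftrightarrow> Re (poly_Q zA zB zAB zAiB (cnj zA) (cnj zB) (cnj zAB) (cnj zAiB)) \<le> 0"
    (is "?pair \<longleftrightarrow> ?Q \<le> 0")
proof -
  \<comment> \<open>\<open>E m\<close> is \<open>A\<close> in an eigenframe, and \<open>F m\<close> is its inverse.\<close>
  define E where "E m = diag3 m (cnj m / m) (1 / cnj m)" for m
  define F where "F m = diag3 (1 / m) (1 / (cnj m / m)) (1 / (1 / cnj m))" for m
  have EF: "E m ** F m = mat 1" if "m \<noteq> 0" for m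
    unfolding E_def F_def using that by (intro diag3_inverse) auto
  have sign: "?Q \<le> 0 \<longleftrightarrow>
      \<bar>1 + (cmod d2)^2 - 2 * Re (d1 * cnj d3)\<bar> \<le> 2 * cmod (d1 * d3 - cnj d2)"
    if "m \<noteq> 0" "zA = m + cnj m / m + 1 / cnj m" "zB = d1 + d2 + d3"
      "zAB = m * d1 + cnj m / m * d2 + 1 / cnj m * d3"
      "zAiB = 1 / m * d1 + 1 / (cnj m / m) * d2 + 1 / (1 / cnj m) * d3" for m d1 d2 d3
  proof -
    let ?T = "1 + (cmod d2)^2 - 2 * Re (d1 * cnj d3)" and ?Y = "cmod (d1 * d3 - cnj d2)"
    have "?Q = goldman_f zA * (?T^2 - 4 * ?Y^2)"
      unfolding poly_Q_diagonal[OF that] by simp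
    then have "?Q \<le> 0 \<longleftrightarrow> ?T^2 - 4 * ?Y^2 \<le> 0"
      using assms(3) by (simp add: mult_le_0_iff)
    also have "\<dots> \<longleftrightarrow> ?T^2 \<le> (2 * ?Y)^2"
      by (simp add: power_mult_distrib)
    also have "\<dots> \<longleftrightarrow> \<bar>?T\<bar> \<le> \<bar>2 * ?Y\<bar>"
      by (rule abs_le_square_iff[symmetric])
    finally show ?thesis by simp
  qed
  show ?thesis
  proof
    assume ?pair
    then obtain A B where A: "A \<in> SU h" and B: "B \<in> SU h" and tr: "trace A = zA" "trace B = zB"
      "trace (A ** B) = zAB" "trace (matrix_inv A ** B) = zAiB"
      by blast
    obtain P R m where P: "witt_frame h P" and R: "P ** R = mat 1" "R ** P = mat 1" and "cmod m > 1"
      and AE: "A = P ** E m ** R"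
      using SU_eigenframe[OF assms(1,2) A] assms(3) unfolding tr E_def by blast
    have m0: "m \<noteq> 0" using \<open>cmod m > 1\<close> by auto
    define M where "M = R ** B ** P"
    have "P ** M ** R = (P ** R) ** B ** (P ** R)"
      by (simp only: M_def matrix_mul_assoc)
    then have BM: "B = P ** M ** R" by (simp add: R)
    then have M: "M \<in> SU witt_form" using SU_conjugate[OF P R] B by simp
    note T = traces_conjugate[OF R EF[OF m0] AE BM, unfolded tr]
    show "?Q \<le> 0"
    proof (subst sign[OF m0])
      show "zA = m + cnj m / m + 1 / cnj m"
        using T(1) by (simp add: E_def diag3_def trace_def sum_3)
      show "zB = M$1$1 + M$2$2 + M$3$3"
        using T(2) by (simp add: trace_def sum_3)
      show "zAB = m * M$1$1 + cnj m / m * M$2$2 + 1 / cnj m * M$3$3"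
        using T(3) unfolding E_def trace_diag3_mult .
      show "zAiB = 1 / m * M$1$1 + 1 / (cnj m / m) * M$2$2 + 1 / (1 / cnj m) * M$3$3"
        using T(4) unfolding F_def trace_diag3_mult .
    qed (rule SU_witt_diagonal_inequality[OF M])
  next
    assume Q: "?Q \<le> 0"
    obtain m where m: "cmod m > 1" and zA: "zA = m + cnj m / m + 1 / cnj m"
      using goldman_f_pos_eigenvalue[OF assms(3)] .
    have m0: "m \<noteq> 0" using m by auto
    define b c where "b = cnj m / m" and "c = 1 / cnj m"
    have "cmod b = 1" "cmod c < 1"
      using m0 m by (simp_all add: b_def c_def norm_divide divide_less_eq)
    then have "m \<noteq> b" "b \<noteq> c" "c \<noteq> m" using m by auto
    moreover have abc: "m * b * c = 1" using m0 by (simp add: b_def c_def)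
    ultimately obtain d1 d2 d3 where d: "zB = d1 + d2 + d3" "zAB = m * d1 + b * d2 + c * d3"
      "zAiB = 1 / m * d1 + 1 / b * d2 + 1 / c * d3"
      by (rule interpolate_diagonal)
    obtain M where M: "M \<in> SU witt_form" and diag: "M$1$1 = d1" "M$2$2 = d2" "M$3$3 = d3"
      using ex_SU_witt_diagonal sign[OF m0 zA d[unfolded b_def c_def]] Q by blast
    obtain P where P: "witt_frame h P" using witt_frame_exists assms(1,2) .
    obtain R where R: "P ** R = mat 1" "R ** P = mat 1" using witt_frame_inverse[OF P] .
    define A B where "A = P ** E m ** R" and "B = P ** M ** R"
    have "E m \<in> SU witt_form"
    proof -
      have "det (E m) = 1" using m0 by (simp add: E_def diag3_def det_3)
      then show ?thesis using m0
        by (simp add: SU_def E_def diag3_mult witt_form_def)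
    qed
    then have SU: "A \<in> SU h" "B \<in> SU h"
      using SU_conjugate[OF P R] M by (simp_all add: A_def B_def)
    note T = traces_conjugate[OF R EF[OF m0] A_def B_def]
    have tr: "trace A = zA" "trace B = zB" "trace (A ** B) = zAB" "trace (matrix_inv A ** B) = zAiB"
      unfolding T unfolding E_def F_def trace_diag3_mult diag
      by (simp_all add: zA d diag trace_def sum_3 diag3_def b_def c_def)
    have "loxodromic h A" "loxodromic h B"
      using goldman_f_pos_imp_loxodromic[OF assms(1,2)] SU assms(3,4) tr by simp_all
    then show ?pair using SU tr by blast
  qed
qed

end
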